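(* Let $\mathbf A$ be regular of bandwidth $(p,q)$, $\sigma=d\tau-\dim\ker\mathbf A$, and let $L\le R$ be finite integers with $N=R-L+1\ge 2\sigma+\tau$. Then $$\mathcal M_{L,R}=\mathbf P_{L,R}\ker\mathbf A\oplus\mathcal F_L^-\oplus\mathcal F_R^+ .$$
   Context: Fix $d\ge1$. $\mathcal V^S_d$: doubly infinite sequences $\Psi=\{\psi_j\}_{j\in\mathbb Z}$, $\psi_j\in\mathbb C^d$. A matrix Laurent polynomial of bandwidth $(p,q)$ is $\sum_{r=p}^qa_rw^r$, integers $p\le q$, $a_r$ complex $d\times d$, $a_p\ne0\ne a_q$; its BBL transformation is $(\mathbf A\Psi)_j=\sum_ra_r\psi_{j+r}$; $\mathbf T$ is the left shift $(\mathbf T\Psi)_j=\psi_{j+1}$, $\mathbf T^{-1}$ the right shift. $\mathbf A$ is regular if $\det(w^{-p}A(w,w^{-1}))$ is not the zero polynomial (then $\ker\mathbf A$ is finite-dimensional). $p'=\min(p,0)$, $q'=\max(0,q)$, $\tau=q'-p'$. For $-\infty\le L\le R\le\infty$: $\mathcal V_{L,R}$ = sequences with $\psi_j=0$ for $j\notin[L,R]$; $\mathbf P_{L,R}$ = projection onto $\mathcal V_{L,R}$ zeroing entries outside $[L,R]$; bulk solution space $\mathcal M_{L,R}=\ker(\mathbf P_{L-p',R-q'}\mathbf A|_{\mathcal V_{L,R}})$ (infinite endpoints stay infinite). Define $\mathcal F_L^-=\{\Psi\in\mathcal M_{L,\infty}: (\mathbf P_{L,\infty}\mathbf T)^k\Psi=0\text{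 for some }k\ge1\}$ and $\mathcal F_R^+=\{\Psi\in\mathcal M_{-\infty,R}: (\mathbf P_{-\infty,R}\mathbf T^{-1})^k\Psi=0\text{ for some }k\ge1\}$; these are finitely supported sequences, regarded as elements of $\mathcal V_{L,R}$. *)

theory Defs
  imports "HOL-Analysis.Analysis" "HOL-Computational_Algebra.Polynomial" "HOL-Library.Function_Algebras"
begin

text \<open>Sequences in V^S_d: int-indexed sequences of vectors in C^d (d = CARD('d)).
  Coefficients of a matrix Laurent polynomial: a :: int => complex^'d^'d.\<close>

type_synonym 'd seq = "int \<Rightarrow> complex ^ 'd"
type_synonym 'd lpoly = "int \<Rightarrow> complex ^ 'd ^ 'd"

definition has_bandwidth :: "'d::finite lpoly \<Rightarrow> int \<Rightarrow> int \<Rightarrow> bool" where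
  "has_bandwidth a p q \<longleftrightarrow> p \<le> q \<and> a p \<noteq> 0 \<and> a q \<noteq> 0 \<and> (\<forall>r. (r < p \<or> q < r) \<longrightarrow> a r = 0)"

definition bbl :: "'d::finite lpoly \<Rightarrow> int \<Rightarrow> int \<Rightarrow> 'd seq \<Rightarrow> 'd seq" where
  "bbl a p q \<Psi> = (\<lambda>j. \<Sum>r\<in>{p..q}. a r *v \<Psi> (j + r))"

text \<open>w^{-p} A(w, w^{-1}) as a matrix of ordinary polynomials.\<close>
definition shifted_symbol :: "'d::finite lpoly \<Rightarrow> int \<Rightarrow> int \<Rightarrow> complex poly ^ 'd ^ 'd" where
  "shifted_symbol a p q = (\<chi> i k. \<Sum>r\<in>{p..q}. monom (a r $ i $ k) (nat (r - p)))"

definition regular :: "'d::finite lpoly \<Rightarrow> int \<Rightarrow> int \<Rightarrow> bool" where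
  "regular a p q \<longleftrightarrow> det (shifted_symbol a p q) \<noteq> 0"

definition seq_scale :: "complex \<Rightarrow> 'd::finite seq \<Rightarrow> 'd seq" where
  "seq_scale c \<Psi> = (\<lambda>j. c *s \<Psi> j)"

definition kerA :: "'d::finite lpoly \<Rightarrow> int \<Rightarrow> int \<Rightarrow> 'd seq set" where
  "kerA a p q = {\<Psi>. bbl a p q \<Psi> = 0}"

definition proj :: "int set \<Rightarrow> 'd::finite seq \<Rightarrow> 'd seq" where
  "proj S \<Psi> = (\<lambda>j. if j \<in> S then \<Psi> j else 0)"

definition Vsub :: "int set \<Rightarrow> 'd::finite seq set" where
  "Vsub S = {\<Psi>. \<forall>j. j \<notin> S \<longrightarrow> \<Psi> j = 0}"

definition shiftL :: "'d::finite seq \<Rightarrow> 'd seq" where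
  "shiftL \<Psi> = (\<lambda>j. \<Psi> (j + 1))"

definition shiftR :: "'d::finite seq \<Rightarrow> 'd seq" where
  "shiftR \<Psi> = (\<lambda>j. \<Psi> (j - 1))"

text \<open>Bulk solution spaces: M_{L,R} = ker (P_{L-p',R-q'} A restricted to V_{L,R}),
  with the three cases (finite, right-infinite, left-infinite).\<close>
definition Mfin :: "'d::finite lpoly \<Rightarrow> int \<Rightarrow> int \<Rightarrow> int \<Rightarrow> int \<Rightarrow> 'd seq set" where
  "Mfin a p q L R = {\<Psi> \<in> Vsub {L..R}.
      proj {L - min p 0 .. R - max 0 q} (bbl a p q \<Psi>) = 0}"

definition Mright :: "'d::finite lpoly \<Rightarrow> int \<Rightarrow> int \<Rightarrow> int \<Rightarrow> 'd seq set" where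
  "Mright a p q L = {\<Psi> \<in> Vsub {L..}. proj {L - min p 0 ..} (bbl a p q \<Psi>) = 0}"

definition Mleft :: "'d::finite lpoly \<Rightarrow> int \<Rightarrow> int \<Rightarrow> int \<Rightarrow> 'd seq set" where
  "Mleft a p q R = {\<Psi> \<in> Vsub {..R}. proj {.. R - max 0 q} (bbl a p q \<Psi>) = 0}"

definition Fminus :: "'d::finite lpoly \<Rightarrow> int \<Rightarrow> int \<Rightarrow> int \<Rightarrow> 'd seq set" where
  "Fminus a p q L = {\<Psi> \<in> Mright a p q L. \<exists>k\<ge>1. ((proj {L..} \<circ> shiftL) ^^ k) \<Psi> = 0}"

definition Fplus :: "'d::finite lpoly \<Rightarrow> int \<Rightarrow> int \<Rightarrow> int \<Rightarrow> 'd seq set" where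
  "Fplus a p q R = {\<Psi> \<in> Mleft a p q R. \<exists>k\<ge>1. ((proj {..R} \<circ> shiftR) ^^ k) \<Psi> = 0}"

definition direct_sum3 :: "'d::finite seq set \<Rightarrow> 'd seq set \<Rightarrow> 'd seq set \<Rightarrow> 'd seq set \<Rightarrow> bool" where
  "direct_sum3 M U V W \<longleftrightarrow>
     M = {u + v + w | u v w. u \<in> U \<and> v \<in> V \<and> w \<in> W} \<and>
     (\<forall>u\<in>U. \<forall>v\<in>V. \<forall>w\<in>W. u + v + w = 0 \<longrightarrow> u = 0 \<and> v = 0 \<and> w = 0)"

definition cdim :: "'d::finite seq set \<Rightarrow> nat" where
  "cdim S = vector_space.dim seq_scale S"

end

theory Submission
  imports Defs
begin

text \<open>
  Write the bulk equations as \<open>\<Sum>i\<le>t. b i *v \<Psi> (k + i) = 0\<close> with \<open>t = \<tau>\<close>. Solutions on overlapping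
  intervals glue as soon as they agree on a window of \<open>t\<close> sites. Regularity enters once: multiplying
  by the adjugate, each component of a kernel sequence is annihilated by the nonzero scalar polynomial
  \<open>det\<close>, so a kernel sequence vanishing near one of the two infinities is zero; by gluing with zero,
  it is then determined by its values on any window of \<open>t\<close> sites.

  Fix such a window; its state space has dimension \<open>d t\<close>. The states that extend \<open>n\<close> sites to the right
  form a decreasing chain which is constant from the first repetition on and always contains the
  states of \<open>ker A\<close>, so it is constant after \<open>\<sigma> = d t - dim (ker A)\<close> steps; such states extend to
  infinity. Likewise on the left. Hence a bulk solution agrees with some \<open>u \<in> ker A\<close> on a window that is
  at distance at least \<open>\<sigma>\<close> from both ends, and the difference splits into two edge solutions.

  Conversely \<open>ker A\<close> and the finitely supported solutions on a half line inject together into the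
  states of the first window. The same chain argument bounds the support of the latter by \<open>\<sigma>\<close>, which gives
  directness.
\<close>

subsection \<open>Kernel sequences of a regular symbol\<close>

text \<open>Cramer's rule over a commutative ring. \<open>D l x\<close> replaces column
  \<open>l\<close> of \<open>A\<close> by \<open>x\<close>, so the entries of \<open>C\<close> are
  cofactors; by linearity in that column, entry \<open>(l, m)\<close> of the product is a
  determinant with column \<open>m\<close> in place \<open>l\<close>, which has two equal columns
  unless \<open>l = m\<close>.\<close>

lemma left_adjugate_exists:
  fixes A :: "'a::comm_ring_1 ^ 'n ^ 'n"
  obtains C :: "'a ^ 'n ^ 'n" where "C ** A = mat (det A)"
proof
  define D where "D l x = det (\<chi> i. if i = l then x else row i (transpose A))" for l x
  let ?C = "\<chi> l k. D l (axis k 1)"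
  have "(\<Sum>k\<in>UNIV. D l (axis k 1) * A $ k $ m) = (if l = m then det A else 0)" for l m
  proof -
    have "(\<Sum>k\<in>UNIV. D l (axis k 1) * A $ k $ m) = (\<Sum>k\<in>UNIV. D l (A $ k $ m *s axis k 1))"
      unfolding D_def by (subst det_row_mul) (simp add: mult.commute)
    also have "\<dots> = D l (\<Sum>k\<in>UNIV. A $ k $ m *s axis k 1)"
      unfolding D_def by (subst det_linear_row_sum) simp_all
    also have "(\<Sum>k\<in>UNIV. A $ k $ m *s axis k 1) = row m (transpose A)"
      by (simp add: vec_eq_iff row_def transpose_def axis_def if_distrib cong: if_cong)
    also have "D l (row m (transpose A)) = (if l = m then det A else 0)"
    proof (cases "l = m")
      case True
      then have "D l (row m (transpose A)) = det (transpose A)"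
        unfolding D_def by (intro arg_cong[where f = det]) (auto simp: vec_eq_iff row_def)
      with True show ?thesis by simp
    next
      case False
      then show ?thesis
        unfolding D_def
        by (simp add: det_identical_rows[OF False] row_def vec_eq_iff)
    qed
    finally show ?thesis .
  qed
  then show "?C ** A = mat (det A)"
    by (simp add: matrix_matrix_mult_def mat_def vec_eq_iff)
qed

section \<open>Bi-infinite sequences as a module over polynomials in the left shift\<close>

definition shift_action :: "'a::comm_ring_1 poly \<Rightarrow> (int \<Rightarrow> 'a) \<Rightarrow> int \<Rightarrow> 'a" where
  "shift_action f x k = (\<Sum>i\<le>degree f. coeff f i * x (k + int i))"

lemma shift_action_altdef:
  assumes "degree f \<le> n"
  shows "shift_action f x k = (\<Sum>i\<le>n. coeff f i * x (k + int i))"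
  unfolding shift_action_def using assms
  by (intro sum.mono_neutral_left) (auto simp: coeff_eq_0)

lemma shift_action_pCons: "shift_action (pCons c f) x k = c * x k + shift_action f x (k + 1)"
proof -
  have "shift_action (pCons c f) x k = (\<Sum>i\<le>Suc (degree f). coeff (pCons c f) i * x (k + int i))"
    by (rule shift_action_altdef) (rule degree_pCons_le)
  then show ?thesis
    unfolding sum.atMost_Suc_shift by (simp add: shift_action_def add.assoc)
qed

lemma shift_action_0 [simp]: "shift_action 0 x k = 0"
  by (simp add: shift_action_def)

lemma shift_action_zero_seq [simp]: "shift_action f (\<lambda>_. 0) k = 0"
  by (simp add: shift_action_def)

lemma shift_action_add: "shift_action (f + g) x k = shift_action f x k + shift_action g x k"
proof -
  let ?n = "max (degree f) (degree g)"
  have "degree (f + g) \<le> ?n" by (rule degree_add_le_max)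
  then show ?thesis
    by (simp add: shift_action_altdef[where n = ?n] sum.distrib distrib_right)
qed

lemma shift_action_sum: "shift_action (sum f S) x k = (\<Sum>s\<in>S. shift_action (f s) x k)"
  by (induction S rule: infinite_finite_induct) (auto simp: shift_action_add)

lemma shift_action_sum_seq:
  "shift_action f (\<lambda>j. \<Sum>s\<in>S. x s j) k = (\<Sum>s\<in>S. shift_action f (x s) k)"
  unfolding shift_action_def sum_distrib_left by (rule sum.swap)

lemma shift_action_smult: "shift_action (smult c f) x k = c * shift_action f x k"
  by (subst shift_action_altdef[OF degree_smult_le])
     (simp add: shift_action_def sum_distrib_left mult.assoc)

text \<open>The module law: it lets the adjugate be applied to a system of shift equations.\<close>

lemma shift_action_mult: "shift_action (f * g) x k = shift_action f (shift_action g x) k"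
  by (induction f arbitrary: k)
     (simp_all add: shift_action_add shift_action_smult shift_action_pCons)

lemma shift_action_monom: "shift_action (monom c n) x k = c * x (k + int n)"
  by (subst shift_action_altdef[OF degree_monom_le]) (simp add: if_distrib[of "\<lambda>u. u * _"] cong: if_cong)

text \<open>The leading coefficient is invertible in the fraction field, so the equation ending at
  the first unknown site forces that site to vanish; zeros spread to the right one site at a
  time.\<close>

lemma shift_action_eq_zero_left:
  fixes f :: "'a::idom poly"
  assumes f: "f \<noteq> 0" and x: "\<And>k. shift_action f x k = 0" and J: "\<And>j. j < J \<Longrightarrow> x j = 0"
  shows "x j = 0"
proof -
  have "\<forall>j < J + int n. x j = 0" for n
  proof (induction n)
    case (Suc n)
    let ?j = "J + int n"
    have "0 = (\<Sum>i\<le>degree f. coeff f i * x (?j - int (degree f) + int i))"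
      using x[of "?j - int (degree f)"] by (simp add: shift_action_def)
    also have "\<dots> = (\<Sum>i\<in>{degree f}. coeff f i * x (?j - int (degree f) + int i))"
      using Suc by (intro sum.mono_neutral_right) auto
    finally have "x ?j = 0" using f by simp
    moreover have "j < ?j \<or> j = ?j" if "j < J + int (Suc n)" for j using that by linarith
    ultimately show ?case using Suc by blast
  qed (use J in simp)
  from this[of "nat (j - J + 1)"] show ?thesis by simp
qed

lemma shift_action_eq_zero_right:
  fixes f :: "'a::idom poly"
  assumes f: "f \<noteq> 0" and x: "\<And>k. shift_action f x k = 0" and J: "\<And>j. j > J \<Longrightarrow> x j = 0"
  shows "x j = 0"
proof -
  \<comment> \<open>The constant coefficient may vanish, so leftward propagation solves for the
    lowest nonzero coefficient instead.\<close>
  define m where "m = (LEAST i. coeff f i \<noteq> 0)"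
  have m: "coeff f m \<noteq> 0" unfolding m_def by (rule LeastI[of _ "degree f"]) (simp add: f)
  have m': "coeff f i = 0" if "i < m" for i using that unfolding m_def by (auto dest: not_less_Least)
  have "\<forall>j > J - int n. x j = 0" for n
  proof (induction n)
    case (Suc n)
    let ?j = "J - int n"
    have "0 = (\<Sum>i\<le>degree f. coeff f i * x (?j - int m + int i))"
      using x[of "?j - int m"] by (simp add: shift_action_def)
    also have "\<dots> = (\<Sum>i\<in>{m}. coeff f i * x (?j - int m + int i))"
    proof (intro sum.mono_neutral_right ballI)
      fix i assume "i \<in> {..degree f} - {m}"
      then consider "i < m" | "i > m" by force
      then show "coeff f i * x (?j - int m + int i) = 0"
        using Suc m' by cases auto
    qed (use m le_degree in auto)
    finally have "x ?j = 0" using m by simp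
    moreover have "j > ?j \<or> j = ?j" if "j > J - int (Suc n)" for j using that by linarith
    ultimately show ?case using Suc by blast
  qed (use J in simp)
  from this[of "nat (J - j + 1)"] show ?thesis by simp
qed

text \<open>Applying the left adjugate to the system decouples it: row \<open>l\<close> of the
  result involves component \<open>l\<close> only, with coefficient \<open>det B\<close>.\<close>

lemma det_annihilates_kernel:
  fixes B :: "complex poly ^ 'd ^ 'd" and \<Psi> :: "'d::finite seq"
  assumes "\<And>i k. (\<Sum>m\<in>UNIV. shift_action (B $ i $ m) (\<lambda>j. \<Psi> j $ m) k) = 0"
  shows "shift_action (det B) (\<lambda>j. \<Psi> j $ l) k = 0"
proof -
  obtain C where C: "C ** B = mat (det B)" by (rule left_adjugate_exists)
  have "shift_action (det B) (\<lambda>j. \<Psi> j $ l) k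
      = (\<Sum>m\<in>UNIV. shift_action (mat (det B) $ l $ m) (\<lambda>j. \<Psi> j $ m) k)"
    by (simp add: mat_def if_distrib[of "\<lambda>u. shift_action u _ _"] cong: if_cong)
  also have "\<dots> = (\<Sum>i\<in>UNIV. shift_action (C $ l $ i)
      (\<lambda>k. \<Sum>m\<in>UNIV. shift_action (B $ i $ m) (\<lambda>j. \<Psi> j $ m) k) k)"
    unfolding C[symmetric] matrix_matrix_mult_def
    by (simp add: shift_action_sum shift_action_sum_seq shift_action_mult) (rule sum.swap)
  also have "\<dots> = 0" by (simp add: assms)
  finally show ?thesis .
qed

text \<open>Multiplying the symbol by \<open>w^{-p}\<close> makes its exponents nonnegative and
  moves the equation at site \<open>k - p\<close> to index \<open>k\<close>.\<close>

lemma bbl_eq_shift_action: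
  "bbl a p q \<Psi> (k - p) $ i
    = (\<Sum>m\<in>UNIV. shift_action (shifted_symbol a p q $ i $ m) (\<lambda>j. \<Psi> j $ m) k)"
proof -
  have "(\<Sum>m\<in>UNIV. shift_action (shifted_symbol a p q $ i $ m) (\<lambda>j. \<Psi> j $ m) k)
      = (\<Sum>m\<in>UNIV. \<Sum>r\<in>{p..q}. a r $ i $ m * \<Psi> (k - p + r) $ m)"
    by (auto simp: shifted_symbol_def shift_action_sum shift_action_monom algebra_simps intro!: sum.cong)
  also have "\<dots> = bbl a p q \<Psi> (k - p) $ i"
    unfolding bbl_def sum_component matrix_vector_mult_def by (simp, rule sum.swap)
  finally show ?thesis ..
qed

lemma regular_kernel_eq_zero:
  assumes "regular a p q" and "\<Psi> \<in> kerA a p q"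
    and "(\<forall>j<J. \<Psi> j = 0) \<or> (\<forall>j>J. \<Psi> j = 0)"
  shows "\<Psi> = 0"
proof -
  let ?f = "det (shifted_symbol a p q)"
  have f: "?f \<noteq> 0" using assms(1) by (simp add: regular_def)
  have "shift_action ?f (\<lambda>j. \<Psi> j $ l) k = 0" for l k
    using assms(2) by (intro det_annihilates_kernel) (simp add: kerA_def flip: bbl_eq_shift_action)
  then have "\<Psi> j $ l = 0" for j l
    using assms(3) shift_action_eq_zero_left[OF f, of "\<lambda>j. \<Psi> j $ l" J j]
      shift_action_eq_zero_right[OF f, of "\<lambda>j. \<Psi> j $ l" J j] by auto
  then show ?thesis by (simp add: fun_eq_iff vec_eq_iff)
qed

subsection \<open>Chains of subspaces seen through a window\<close>

interpretation seqs: vector_space "seq_scale :: complex \<Rightarrow> 'd::finite seq \<Rightarrow> 'd seq"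
  by unfold_locales (auto simp: seq_scale_def fun_eq_iff vec_eq_iff algebra_simps)

text \<open>Each strict inclusion supplies a vector outside the span found so far. Explicit
  independent sets are counted because the \<open>U n\<close> are not assumed
  finite-dimensional.\<close>

lemma (in vector_space) independent_along_strict_chain:
  assumes "\<And>n. n \<le> m \<Longrightarrow> subspace (U n)" and "\<And>n. n < m \<Longrightarrow> U n \<subset> U (Suc n)"
    and B: "independent B" "finite B" "B \<subseteq> U 0"
  shows "\<exists>B'. independent B' \<and> finite B' \<and> B' \<subseteq> U m \<and> card B' = card B + m"
  using assms(1,2)
proof (induction m)
  case 0
  with B show ?case by auto
next
  case (Suc m)
  then obtain B' where B': "independent B'" "finite B'" "B' \<subseteq> U m" "card B' = card B + m"
    by force
  from Suc.prems(2)[of m] obtain x where x: "x \<in> U (Suc m)" "x \<notin> U m" by blast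
  have "span B' \<subseteq> U m" using B'(3) Suc.prems(1)[of m] by (intro span_minimal) auto
  with x have "x \<notin> span B'" by blast
  moreover from x B' have "x \<notin> B'" by blast
  ultimately have "independent (insert x B')" "finite (insert x B')"
      "insert x B' \<subseteq> U (Suc m)" "card (insert x B') = card B + Suc m"
    using B' x Suc.prems(2)[of m] by (auto simp: independent_insert)
  then show ?case by blast
qed

section \<open>Restriction to a window as a linear map\<close>

lemma proj_eq_0_iff: "proj S \<Psi> = 0 \<longleftrightarrow> (\<forall>j\<in>S. \<Psi> j = 0)"
  by (auto simp: proj_def fun_eq_iff)

lemma proj_eq_iff: "proj S \<Psi> = proj S \<Phi> \<longleftrightarrow> (\<forall>j\<in>S. \<Psi> j = \<Phi> j)"
  by (auto simp: proj_def fun_eq_iff)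

lemma proj_add: "proj S (\<Psi> + \<Phi>) = proj S \<Psi> + proj S \<Phi>"
  by (auto simp: proj_def fun_eq_iff)

lemma proj_scale: "proj S (seq_scale c \<Psi>) = seq_scale c (proj S \<Psi>)"
  by (auto simp: proj_def seq_scale_def fun_eq_iff)

lemma proj_linear: "Vector_Spaces.linear seq_scale seq_scale (proj S)"
  unfolding linear_iff_module_hom module_hom_iff
  by (simp add: proj_add proj_scale seqs.module_axioms)

lemma Vsub_window_spanned:
  fixes c :: int and t :: nat
  obtains E :: "'d::finite seq set" where "finite E" "card E \<le> CARD('d) * t"
    "Vsub {c..<c + int t} \<subseteq> seqs.span E"
proof
  define W where "W = {c..<c + int t}"
  \<comment> \<open>The unit sequence at site \<open>j\<close> in component
    \<open>i\<close>.\<close>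
  define e :: "int \<times> 'd \<Rightarrow> 'd seq" where "e = (\<lambda>(j, i) k. if k = j then axis i 1 else 0)"
  let ?E = "e ` (W \<times> UNIV)"
  have W: "finite W" "card W = t" by (auto simp: W_def)
  then show "finite ?E" by simp
  show "card ?E \<le> CARD('d) * t"
    using card_image_le[of "W \<times> UNIV" e] W by (simp add: card_cartesian_product mult.commute)
  have "\<Psi> = (\<Sum>x\<in>W \<times> UNIV. seq_scale (\<Psi> (fst x) $ snd x) (e x))" if "\<Psi> \<in> Vsub W" for \<Psi>
  proof (intro ext)
    fix k
    have app: "sum f S k = (\<Sum>x\<in>S. f x k)" for f :: "int \<times> 'd \<Rightarrow> 'd seq" and S
      by (induction S rule: infinite_finite_induct) auto
    have "(\<Sum>x\<in>W \<times> UNIV. seq_scale (\<Psi> (fst x) $ snd x) (e x)) k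
        = (\<Sum>j\<in>W. \<Sum>i\<in>UNIV. \<Psi> j $ i *s (if k = j then axis i 1 else 0))"
      unfolding app by (simp add: sum.cartesian_product seq_scale_def e_def case_prod_unfold)
    also have "\<dots> = (\<Sum>j\<in>W. if k = j then \<Psi> j else 0)"
      by (intro sum.cong) (auto simp: vec_eq_iff axis_def if_distrib cong: if_cong)
    also have "\<dots> = \<Psi> k" using that W by (auto simp: Vsub_def)
    finally show "\<Psi> k = (\<Sum>x\<in>W \<times> UNIV. seq_scale (\<Psi> (fst x) $ snd x) (e x)) k" ..
  qed
  note expand = this
  show "Vsub {c..<c + int t} \<subseteq> seqs.span ?E"
    unfolding W_def[symmetric]
  proof
    fix \<Psi> :: "'d seq" assume "\<Psi> \<in> Vsub W"
    then show "\<Psi> \<in> seqs.span ?E"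
      by (subst expand) (auto intro!: seqs.span_sum seqs.span_scale intro: seqs.span_base)
  qed
qed

text \<open>Restriction to the window is injective on \<open>X\<close>, so it carries
  \<open>B\<close> to an independent set in a space spanned by \<open>d t\<close> vectors.\<close>

lemma card_independent_window:
  fixes B :: "'d::finite seq set"
  assumes "seqs.independent B" "B \<subseteq> X" "seqs.subspace X"
    and X: "\<And>\<Psi>. \<Psi> \<in> X \<Longrightarrow> (\<forall>j\<in>{c..<c + int t}. \<Psi> j = 0) \<Longrightarrow> \<Psi> = 0"
  shows "finite B \<and> card B \<le> CARD('d) * t"
proof -
  let ?P = "proj {c..<c + int t}"
  interpret P: Vector_Spaces.linear seq_scale seq_scale ?P by (rule proj_linear)
  have span: "seqs.span B \<subseteq> X" using assms by (intro seqs.span_minimal)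
  have inj: "inj_on ?P (seqs.span B)"
    unfolding P.inj_on_iff_eq_0[OF seqs.subspace_span] using X span by (auto simp: proj_eq_0_iff)
  then have "seqs.independent (?P ` B)" using assms(1) by (intro P.independent_injective_image)
  moreover obtain E where E: "finite E" "card E \<le> CARD('d) * t"
      "Vsub {c..<c + int t} \<subseteq> seqs.span (E :: 'd seq set)"
    by (rule Vsub_window_spanned)
  moreover have "?P ` B \<subseteq> Vsub {c..<c + int t}" by (auto simp: proj_def Vsub_def)
  ultimately have "finite (?P ` B) \<and> card (?P ` B) \<le> card E"
    by (intro seqs.independent_span_bound) auto
  moreover have "inj_on ?P B" using inj by (rule inj_on_subset) (rule seqs.span_superset)
  ultimately show ?thesis using E(2) by (auto simp: card_image dest: finite_imageD)
qed

text \<open>With \<open>s + 1\<close> strict steps, \<open>card B + s + 1\<close> independent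
  vectors would fit into a window of dimension \<open>d t\<close>. It serves both an increasing
  chain and, read backwards, a decreasing one; \<open>B\<close> comes from a basis of the
  kernel.\<close>

lemma window_chain_stabilises:
  fixes B :: "'d::finite seq set"
  assumes U: "\<And>n. n \<le> Suc s \<Longrightarrow> seqs.subspace (U n)" "\<And>n. n \<le> s \<Longrightarrow> U n \<subseteq> U (Suc n)"
    and inj: "\<And>\<Psi>. \<Psi> \<in> U (Suc s) \<Longrightarrow> (\<forall>j\<in>{c..<c + int t}. \<Psi> j = 0) \<Longrightarrow> \<Psi> = 0"
    and B: "seqs.independent B" "B \<subseteq> U 0" and s: "CARD('d) * t \<le> card B + s"
  shows "\<exists>n\<le>s. U n = U (Suc n)"
proof (rule ccontr)
  assume "\<not> (\<exists>n\<le>s. U n = U (Suc n))"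
  then have strict: "U n \<subset> U (Suc n)" if "n < Suc s" for n
    using U(2)[of n] that by auto
  have "U 0 \<subseteq> U n" if "n \<le> Suc s" for n
    using that by (induction n) (use U(2) in force)+
  with B have "B \<subseteq> U (Suc s)" by blast
  with B U inj have "finite B" using card_independent_window[of B "U (Suc s)" c t] by auto
  then obtain B' where "seqs.independent B'" "B' \<subseteq> U (Suc s)" "card B' = card B + Suc s"
    using seqs.independent_along_strict_chain[of "Suc s" U B] U strict B by auto
  then have "card B + Suc s \<le> CARD('d) * t"
    using card_independent_window[of B' "U (Suc s)" c t] U inj by auto
  with s show False by simp
qed

subsection \<open>Matrix recurrences on sets of sites\<close>

definition rec_eq :: "(nat \<Rightarrow> complex ^ 'd ^ 'd) \<Rightarrow> nat \<Rightarrow> 'd::finite seq \<Rightarrow> int \<Rightarrow> complex ^ 'd" where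
  "rec_eq b t \<Psi> k = (\<Sum>i\<le>t. b i *v \<Psi> (k + int i))"

text \<open>An equation is imposed only if its whole block of \<open>t + 1\<close> sites lies in
  \<open>I\<close>, and values off \<open>I\<close> are free. Support is prescribed separately by
  \<open>Vsub\<close>, so kernel, half-line and interval solutions share one notion.\<close>

definition Sol :: "(nat \<Rightarrow> complex ^ 'd ^ 'd) \<Rightarrow> nat \<Rightarrow> int set \<Rightarrow> 'd::finite seq set" where
  "Sol b t I = {\<Psi>. \<forall>k. {k..k + int t} \<subseteq> I \<longrightarrow> rec_eq b t \<Psi> k = 0}"

lemma SolI: "(\<And>k. {k..k + int t} \<subseteq> I \<Longrightarrow> rec_eq b t \<Psi> k = 0) \<Longrightarrow> \<Psi> \<in> Sol b t I"
  by (simp add: Sol_def)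

lemma SolD: "\<Psi> \<in> Sol b t I \<Longrightarrow> {k..k + int t} \<subseteq> I \<Longrightarrow> rec_eq b t \<Psi> k = 0"
  by (simp add: Sol_def)

lemma Sol_antimono: "\<Psi> \<in> Sol b t J \<Longrightarrow> I \<subseteq> J \<Longrightarrow> \<Psi> \<in> Sol b t I"
  by (auto simp: Sol_def)

lemma rec_eq_cong:
  "(\<And>j. k \<le> j \<Longrightarrow> j \<le> k + int t \<Longrightarrow> \<Psi> j = \<Phi> j) \<Longrightarrow> rec_eq b t \<Psi> k = rec_eq b t \<Phi> k"
  unfolding rec_eq_def by (intro sum.cong) auto

lemma Sol_cong:
  assumes "\<Psi> \<in> Sol b t I" "\<And>j. j \<in> I \<Longrightarrow> \<Phi> j = \<Psi> j"
  shows "\<Phi> \<in> Sol b t I"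
proof (rule SolI)
  fix k assume k: "{k..k + int t} \<subseteq> I"
  then have "rec_eq b t \<Phi> k = rec_eq b t \<Psi> k" by (intro rec_eq_cong assms(2)) auto
  with k assms(1) show "rec_eq b t \<Phi> k = 0" by (simp add: SolD)
qed

lemma subspace_Sol: "seqs.subspace (Sol b t I)"
proof (rule seqs.subspaceI)
  show "0 \<in> Sol b t I" by (simp add: Sol_def rec_eq_def)
next
  fix x y assume "x \<in> Sol b t I" "y \<in> Sol b t I"
  moreover have "rec_eq b t (x + y) k = rec_eq b t x k + rec_eq b t y k" for k
    by (simp add: rec_eq_def matrix_vector_right_distrib sum.distrib)
  ultimately show "x + y \<in> Sol b t I" by (simp add: Sol_def)
next
  fix c x assume "x \<in> Sol b t I"
  moreover have "rec_eq b t (seq_scale c x) k = c *s rec_eq b t x k" for k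
    by (simp add: rec_eq_def seq_scale_def vector_scalar_commute vec.scale_sum_right)
  ultimately show "seq_scale c x \<in> Sol b t I" by (simp add: Sol_def)
qed

lemma zero_in_Sol: "(\<lambda>_. 0) \<in> Sol b t I"
  by (simp add: Sol_def rec_eq_def)

lemma subspace_Vsub: "seqs.subspace (Vsub S)"
  by (auto simp: seqs.subspace_def Vsub_def seq_scale_def)

lemma Sol_translate: "\<Psi> \<in> Sol b t I \<Longrightarrow> (\<lambda>j. \<Psi> (j + m)) \<in> Sol b t {j. j + m \<in> I}"
proof (rule SolI)
  fix k assume \<Psi>: "\<Psi> \<in> Sol b t I" and k: "{k..k + int t} \<subseteq> {j. j + m \<in> I}"
  have "j \<in> I" if "j \<in> {k + m..k + m + int t}" for j
    using k that by (auto simp: subset_iff dest: spec[of _ "j - m"])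
  then have "rec_eq b t \<Psi> (k + m) = 0" by (intro SolD[OF \<Psi>]) auto
  then show "rec_eq b t (\<lambda>j. \<Psi> (j + m)) k = 0" by (simp add: rec_eq_def algebra_simps)
qed

text \<open>Every block of \<open>t + 1\<close> consecutive sites starting left of \<open>c\<close> ends left of \<open>c + t\<close>, so an
  overlap of \<open>t\<close> sites is enough to glue.\<close>
lemma Sol_glue:
  assumes "\<Psi> \<in> Sol b t (I \<inter> {c..})" "\<Phi> \<in> Sol b t (I \<inter> {..<c + int t})"
    and "\<And>j. c \<le> j \<Longrightarrow> j < c + int t \<Longrightarrow> \<Psi> j = \<Phi> j"
  shows "(\<lambda>j. if c \<le> j then \<Psi> j else \<Phi> j) \<in> Sol b t I" (is "?G \<in> _")
proof (rule SolI)
  fix k assume k: "{k..k + int t} \<subseteq> I"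
  show "rec_eq b t ?G k = 0"
  proof (cases "c \<le> k")
    case True
    then have "rec_eq b t ?G k = rec_eq b t \<Psi> k" by (intro rec_eq_cong) auto
    with True k show ?thesis using SolD[OF assms(1), of k] by auto
  next
    case False
    then have "rec_eq b t ?G k = rec_eq b t \<Phi> k" using assms(3) by (intro rec_eq_cong) auto
    moreover have "{k..k + int t} \<subseteq> I \<inter> {..<c + int t}" using False k by auto
    ultimately show ?thesis using SolD[OF assms(2), of k] by simp
  qed
qed

text \<open>Reversing the sites reverses the coefficients: the block starting at \<open>k\<close> is
  the mirror image of the one starting at \<open>- k - t\<close>.\<close>

lemma Sol_reflect:
  assumes "\<Psi> \<in> Sol b t I"
  shows "(\<lambda>j. \<Psi> (- j)) \<in> Sol (\<lambda>i. b (t - i)) t {j. - j \<in> I}"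
proof (rule SolI)
  fix k assume k: "{k..k + int t} \<subseteq> {j. - j \<in> I}"
  have "j \<in> I" if "j \<in> {- k - int t..- k - int t + int t}" for j
    using k that by (auto simp: subset_iff dest: spec[of _ "- j"])
  then have "rec_eq b t \<Psi> (- k - int t) = 0" by (intro SolD[OF assms]) auto
  also have "rec_eq b t \<Psi> (- k - int t) = rec_eq (\<lambda>i. b (t - i)) t (\<lambda>j. \<Psi> (- j)) k"
    unfolding rec_eq_def
    by (rule sum.reindex_bij_witness[of _ "\<lambda>i. t - i" "\<lambda>i. t - i"]) (auto simp: of_nat_diff algebra_simps)
  finally show "rec_eq (\<lambda>i. b (t - i)) t (\<lambda>j. \<Psi> (- j)) k = 0" .
qed

lemma Sol_reflect_back:
  assumes "\<Psi> \<in> Sol (\<lambda>i. b (t - i)) t I"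
  shows "(\<lambda>j. \<Psi> (- j)) \<in> Sol b t {j. - j \<in> I}"
proof -
  have "Sol (\<lambda>i. b (t - (t - i))) t J = Sol b t J" for J
    by (simp add: Sol_def rec_eq_def)
  with Sol_reflect[OF assms] show ?thesis by simp
qed

section \<open>Recurrences with uniqueness from either infinity; the end coefficients may be
  singular or zero\<close>

locale regular_recurrence =
  fixes b :: "nat \<Rightarrow> complex ^ 'd ^ 'd::finite" and t :: nat
  assumes left_zero: "\<Psi> \<in> Sol b t UNIV \<Longrightarrow> (\<And>j. j < J \<Longrightarrow> \<Psi> j = 0) \<Longrightarrow> \<Psi> = 0"
    and right_zero: "\<Psi> \<in> Sol b t UNIV \<Longrightarrow> (\<And>j. j > J \<Longrightarrow> \<Psi> j = 0) \<Longrightarrow> \<Psi> = 0"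
begin

text \<open>Reflection exchanges the two axioms, so every result about one end transfers to the
  other.\<close>

lemma reflected: "regular_recurrence (\<lambda>i. b (t - i)) t"
proof
  fix \<Psi> J assume \<Psi>: "\<Psi> \<in> Sol (\<lambda>i. b (t - i)) t UNIV"
  have \<Psi>': "(\<lambda>j. \<Psi> (- j)) \<in> Sol b t UNIV"
    using Sol_reflect_back[OF \<Psi>] by simp
  have "\<Psi> = 0" if "(\<lambda>j. \<Psi> (- j)) = 0"
  proof
    fix j show "\<Psi> j = 0 j" using fun_cong[OF that, of "- j"] by simp
  qed
  then show "\<Psi> = 0" if "\<And>j. j < J \<Longrightarrow> \<Psi> j = 0"
    using right_zero[OF \<Psi>', of "- J"] that by simp
  show "\<Psi> = 0" if "\<And>j. j > J \<Longrightarrow> \<Psi> j = 0"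
    using left_zero[OF \<Psi>', of "- J"] that \<open>(\<lambda>j. \<Psi> (- j)) = 0 \<Longrightarrow> \<Psi> = 0\<close> by simp
qed

lemma half_line_zero:
  assumes \<Psi>: "\<Psi> \<in> Sol b t {c..}" and W: "\<And>j. c \<le> j \<Longrightarrow> j < c + int t \<Longrightarrow> \<Psi> j = 0" and "c \<le> j"
  shows "\<Psi> j = 0"
proof -
  \<comment> \<open>The zero window allows gluing with the zero sequence on the left.\<close>
  have "(\<lambda>j. if c \<le> j then \<Psi> j else 0) \<in> Sol b t UNIV"
    using \<Psi> W zero_in_Sol by (intro Sol_glue) auto
  then have "(\<lambda>j. if c \<le> j then \<Psi> j else 0) = 0" by (rule left_zero[of _ c]) auto
  from fun_cong[OF this, of j] \<open>c \<le> j\<close> show ?thesis by simp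
qed

lemma kernel_zero_window:
  assumes \<Psi>: "\<Psi> \<in> Sol b t UNIV" and W: "\<And>j. c \<le> j \<Longrightarrow> j < c + int t \<Longrightarrow> \<Psi> j = 0"
  shows "\<Psi> = 0"
  by (rule right_zero[OF \<Psi>, of "c - 1"], rule ccontr)
     (use half_line_zero[OF Sol_antimono[OF \<Psi>], of c] W in auto)

text \<open>The sums \<open>U n\<close> of the kernel and the edge solutions \<open>F n\<close> on
  \<open>n\<close> sites are determined by the first window, hence repeat at some
  \<open>m \<le> s\<close>. Directness turns this into \<open>F (Suc m) = F m\<close>, and truncated
  shifts carry the equality to all longer supports.\<close>

lemma left_edge_support:
  assumes B: "seqs.independent B" "B \<subseteq> Sol b t UNIV" and s: "CARD('d) * t \<le> card B + s"
    and v: "v \<in> Sol b t {L..}" "v \<in> Vsub {L..<L + int n}"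
  shows "v \<in> Vsub {L..<L + int s}"
proof -
  define F where "F n = Sol b t {L..} \<inter> Vsub {L..<L + int n}" for n
  define U where "U n = {x + y |x y. x \<in> Sol b t UNIV \<and> y \<in> F n}" for n
  have sF: "seqs.subspace (F n)" for n
    unfolding F_def by (intro seqs.subspace_inter subspace_Sol subspace_Vsub)
  have F_mono: "F n \<subseteq> F m" if "n \<le> m" for n m using that by (auto simp: F_def Vsub_def)
  \<comment> \<open>Since \<open>x + y\<close> vanishes on the half line, \<open>x\<close> vanishes
    to the right of the support of \<open>y\<close>, and uniqueness from the right applies.\<close>
  have direct: "x = 0 \<and> y = 0"
    if x: "x \<in> Sol b t UNIV" and y: "y \<in> F n" and W: "\<forall>j\<in>{L..<L + int t}. (x + y) j = 0" for x y n
  proof -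
    have "x + y \<in> Sol b t {L..}"
      using x y by (intro seqs.subspace_add[OF subspace_Sol]) (auto simp: F_def intro: Sol_antimono)
    then have *: "(x + y) j = 0" if "j \<ge> L" for j
      by (rule half_line_zero) (use W that in auto)
    have "x = 0"
    proof (rule right_zero[OF x])
      fix j assume "j > L + int n"
      then show "x j = 0" using *[of j] y by (auto simp: F_def Vsub_def)
    qed
    moreover have "y j = 0" for j
      using *[of j] \<open>x = 0\<close> y by (cases "j \<ge> L") (auto simp: F_def Vsub_def)
    ultimately show ?thesis by auto
  qed
  have "\<exists>n\<le>s. U n = U (Suc n)"
  proof (rule window_chain_stabilises)
    show "seqs.subspace (U n)" for n
      unfolding U_def by (intro seqs.subspace_sums subspace_Sol sF)
    show "U n \<subseteq> U (Suc n)" for n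
      unfolding U_def using F_mono[of n "Suc n"] by auto
    show "\<Psi> = 0" if "\<Psi> \<in> U (Suc s)" "\<forall>j\<in>{L..<L + int t}. \<Psi> j = 0" for \<Psi>
      using that direct unfolding U_def by force
    show "B \<subseteq> U 0"
    proof
      fix x assume "x \<in> B"
      then have "x = x + 0 \<and> x \<in> Sol b t UNIV \<and> 0 \<in> F 0"
        using B(2) seqs.subspace_0[OF sF] by auto
      then show "x \<in> U 0" unfolding U_def by blast
    qed
  qed fact+
  then obtain m where m: "m \<le> s" "U m = U (Suc m)" by blast
  have Fm: "F (Suc m) \<subseteq> F m"
  proof
    fix v assume v: "v \<in> F (Suc m)"
    then have "0 + v \<in> U (Suc m)" unfolding U_def using seqs.subspace_0[OF subspace_Sol] by blast
    then have "v \<in> U m" using m(2) by simp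
    then obtain x y where xy: "x \<in> Sol b t UNIV" "y \<in> F m" "v = x + y"
      unfolding U_def by auto
    have "y - v \<in> F (Suc m)" using v xy(2) F_mono[of m "Suc m"] by (intro seqs.subspace_diff[OF sF]) auto
    then have "x = 0" using direct[OF xy(1)] xy(3) by simp
    with xy show "v \<in> F m" by simp
  qed
  have "F (m + k) \<subseteq> F m" for k
  proof (induction k)
    case (Suc k)
    have "v \<in> F (m + k)" if v: "v \<in> F (m + Suc k)" for v
    proof -
      \<comment> \<open>Shifting left and cutting at \<open>L\<close> shortens the support by one
        site; the induction hypothesis then puts \<open>v'\<close> in \<open>F m\<close>, which
        confines \<open>v\<close> to \<open>m + 1\<close> sites.\<close>
      define v' where "v' = proj {L..} (\<lambda>j. v (j + 1))"
      have "(\<lambda>j. v (j + 1)) \<in> Sol b t {j. j + 1 \<in> {L..}}"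
        using v by (intro Sol_translate) (auto simp: F_def)
      then have "(\<lambda>j. v (j + 1)) \<in> Sol b t {L..}" by (rule Sol_antimono) auto
      then have "v' \<in> Sol b t {L..}" by (rule Sol_cong) (auto simp: v'_def proj_def)
      moreover have "v' \<in> Vsub {L..<L + int (m + k)}"
        using v by (auto simp: v'_def proj_def Vsub_def F_def)
      ultimately have "v' \<in> F m" using Suc by (auto simp: F_def)
      then have *: "v (j + 1) = 0" if "j \<ge> L + int m" for j
      proof -
        have "v' j = 0" using \<open>v' \<in> F m\<close> that by (auto simp: F_def Vsub_def)
        with that show ?thesis by (simp add: v'_def proj_def)
      qed
      have "v j = 0" if "j \<notin> {L..<L + int (Suc m)}" for j
      proof (cases "j < L")
        case True with v show ?thesis by (auto simp: F_def Vsub_def)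
      next
        case False with that *[of "j - 1"] show ?thesis by auto
      qed
      then have "v \<in> F (Suc m)" using v by (auto simp: F_def Vsub_def)
      with Fm have "v \<in> F m" by blast
      then show ?thesis using F_mono[of m "m + k"] by auto
    qed
    with Suc show ?case by blast
  qed simp
  from this[of n] have "F n \<subseteq> F m" using F_mono[of n "m + n"] by auto
  moreover have "v \<in> F n" using v by (simp add: F_def)
  ultimately show ?thesis using F_mono[OF m(1)] by (auto simp: F_def)
qed

text \<open>Agreement is claimed on the first window only: further right, the continuation to
  infinity may differ from \<open>\<Psi>\<close>.\<close>

lemma extend_right:
  assumes B: "seqs.independent B" "B \<subseteq> Sol b t UNIV" and s: "CARD('d) * t \<le> card B + s"
    and \<Psi>: "\<Psi> \<in> Sol b t {c..<c + int t + int s}"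
  shows "\<exists>\<Phi>\<in>Sol b t {c..}. \<forall>j\<in>{c..<c + int t}. \<Phi> j = \<Psi> j"
proof -
  define P where "P = (proj {c..<c + int t} :: 'd seq \<Rightarrow> 'd seq)"
  define U where "U n = P ` Sol b t {c..<c + int t + int n}" for n
  interpret P: Vector_Spaces.linear seq_scale seq_scale P unfolding P_def by (rule proj_linear)
  have P_eq: "P x = P y \<longleftrightarrow> (\<forall>j\<in>{c..<c + int t}. x j = y j)" for x y
    unfolding P_def by (rule proj_eq_iff)
  have PP: "P (P x) = P x" for x by (auto simp: P_def proj_def)
  have sU: "seqs.subspace (U n)" for n
    unfolding U_def by (intro P.subspace_image subspace_Sol)
  have U_anti: "U n \<subseteq> U m" if "m \<le> n" for n m
    unfolding U_def using that by (intro image_mono) (auto intro: Sol_antimono)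
  \<comment> \<open>The decreasing chain is read backwards from \<open>U (Suc s)\<close>, which
    already contains the window states of the kernel vectors in \<open>B\<close>.\<close>
  have "\<exists>n\<le>s. U (Suc s - n) = U (Suc s - Suc n)"
  proof (rule window_chain_stabilises[where B = "P ` B" and c = c and t = t])
    show "U (Suc s - n) \<subseteq> U (Suc s - Suc n)" for n by (rule U_anti) simp
    show "x = 0" if x: "x \<in> U (Suc s - Suc s)" "\<forall>j\<in>{c..<c + int t}. x j = 0" for x
    proof -
      have "x = P x" using x(1) PP by (auto simp: U_def)
      also have "\<dots> = 0" using x(2) by (simp add: P_def proj_eq_0_iff)
      finally show ?thesis .
    qed
    have "seqs.span B \<subseteq> Sol b t UNIV" using B(2) subspace_Sol by (rule seqs.span_minimal)
    then have inj: "inj_on P (seqs.span B)"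
      unfolding P.inj_on_iff_eq_0[OF seqs.subspace_span]
      by (auto simp: P_def proj_eq_0_iff intro!: kernel_zero_window[of _ c])
    then show "seqs.independent (P ` B)" using B(1) by (intro P.independent_injective_image)
    have "inj_on P B" using inj by (rule inj_on_subset) (rule seqs.span_superset)
    then show "CARD('d) * t \<le> card (P ` B) + s" using s by (simp add: card_image)
    show "P ` B \<subseteq> U (Suc s - 0)"
      unfolding U_def using B(2) by (intro image_mono) (auto intro: Sol_antimono)
  qed (rule sU)
  then obtain n where n: "n \<le> s" "U (Suc s - n) = U (s - n)" by auto
  define m where "m = s - n"
  have m: "m \<le> s" "U m \<subseteq> U (Suc m)" using n by (auto simp: m_def Suc_diff_le)
  \<comment> \<open>a window state that can be continued by \<open>m\<close> sites can be continued by one site to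
    another such state, hence indefinitely\<close>
  have "\<exists>\<Phi>. \<Phi> \<in> Sol b t {c..<c + int t + int (Suc m)} \<and> P \<Phi> = y" if "y \<in> U m" for y
  proof -
    have "y \<in> U (Suc m)" using that m(2) by blast
    then show ?thesis unfolding U_def by blast
  qed
  then obtain g where g: "\<And>y. y \<in> U m \<Longrightarrow> g y \<in> Sol b t {c..<c + int t + int (Suc m)}"
    "\<And>y. y \<in> U m \<Longrightarrow> P (g y) = y" by metis
  \<comment> \<open>\<open>y n\<close> is the state after \<open>n\<close> moves of the window:
    continue by \<open>g\<close>, move one site, restrict again.\<close>
  define y where "y n = ((\<lambda>y. P (\<lambda>j. g y (j + 1))) ^^ n) (P \<Psi>)" for n
  have y: "y n \<in> U m" for n
  proof (induction n)
    case 0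
    have "P \<Psi> \<in> U s" using \<Psi> by (simp add: U_def)
    with U_anti[OF m(1)] show ?case by (auto simp: y_def)
  next
    case (Suc n)
    have "(\<lambda>j. g (y n) (j + 1)) \<in> Sol b t {j. j + 1 \<in> {c..<c + int t + int (Suc m)}}"
      by (intro Sol_translate g Suc)
    then have "(\<lambda>j. g (y n) (j + 1)) \<in> Sol b t {c..<c + int t + int m}"
      by (rule Sol_antimono) auto
    then show ?case by (simp add: y_def U_def)
  qed
  define \<Phi> where "\<Phi> j = g (y (nat (j - c))) c" for j
  \<comment> \<open>\<open>\<Phi>\<close> reads only the first site of each chosen continuation.
    Consecutive continuations agree on their overlap, so it also matches the next \<open>t\<close>
    sites, enough for one full block of \<open>t + 1\<close>.\<close>
  have \<Phi>: "\<Phi> (c + int n + int i) = g (y n) (c + int i)" if "i \<le> t" for n i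
    using that
  proof (induction i arbitrary: n)
    case 0
    then show ?case by (simp add: \<Phi>_def)
  next
    case (Suc i)
    have "\<Phi> (c + int n + int (Suc i)) = \<Phi> (c + int (Suc n) + int i)" by (simp add: algebra_simps)
    also have "\<dots> = g (y (Suc n)) (c + int i)" using Suc.prems by (intro Suc.IH) simp
    also have "\<dots> = g (y n) (c + int i + 1)"
    proof -
      have "P (g (y (Suc n))) = P (P (\<lambda>j. g (y n) (j + 1)))"
        using g(2)[OF y[of "Suc n"]] by (simp add: y_def PP)
      then show ?thesis unfolding PP P_eq using Suc.prems by simp
    qed
    finally show ?case by (simp add: algebra_simps)
  qed
  have "\<Phi> \<in> Sol b t {c..}"
  proof (rule SolI)
    fix k assume "{k..k + int t} \<subseteq> {c..}"
    then obtain n where k: "k = c + int n" by (auto simp: zle_iff_zadd)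
    have "rec_eq b t \<Phi> k = rec_eq b t (g (y n)) c"
      unfolding rec_eq_def k by (intro sum.cong) (auto simp: \<Phi>)
    also have "\<dots> = 0" by (rule SolD[OF g(1)[OF y]]) auto
    finally show "rec_eq b t \<Phi> k = 0" .
  qed
  moreover have "\<Phi> j = \<Psi> j" if j: "j \<in> {c..<c + int t}" for j
  proof -
    have "P (g (y 0)) = P \<Psi>" using g(2)[OF y[of 0]] by (simp add: y_def)
    then have "g (y 0) j = \<Psi> j" using j by (simp add: P_eq)
    moreover have "\<Phi> j = g (y 0) j" using \<Phi>[of "nat (j - c)" 0] j by (simp add: nat_le_iff)
    ultimately show ?thesis by simp
  qed
  ultimately show ?thesis by blast
qed

lemma reflected_independent:
  assumes "seqs.independent B" "B \<subseteq> Sol b t UNIV"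
  obtains B' where "seqs.independent B'" "B' \<subseteq> Sol (\<lambda>i. b (t - i)) t UNIV" "card B' = card B"
proof
  define r :: "'d seq \<Rightarrow> 'd seq" where "r = (\<lambda>\<Psi> j. \<Psi> (- j))"
  interpret r: Vector_Spaces.linear seq_scale seq_scale r
    unfolding linear_iff_module_hom module_hom_iff
    by (simp add: seqs.module_axioms r_def seq_scale_def fun_eq_iff)
  have inj: "inj r" by (rule inj_on_inverseI[of _ r]) (simp add: r_def)
  show "seqs.independent (r ` B)"
    using assms(1) inj by (intro r.independent_injective_image) (auto intro: inj_on_subset)
  show "r ` B \<subseteq> Sol (\<lambda>i. b (t - i)) t UNIV"
    using assms(2) Sol_reflect[of _ b t UNIV] by (auto simp: r_def)
  show "card (r ` B) = card B" using inj by (intro card_image) (auto intro: inj_on_subset)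
qed

lemma extend_left:
  assumes B: "seqs.independent B" "B \<subseteq> Sol b t UNIV" and s: "CARD('d) * t \<le> card B + s"
    and \<Psi>: "\<Psi> \<in> Sol b t {c - int s..<c + int t}"
  shows "\<exists>\<Phi>\<in>Sol b t {..<c + int t}. \<forall>j\<in>{c..<c + int t}. \<Phi> j = \<Psi> j"
proof -
  interpret r: regular_recurrence "\<lambda>i. b (t - i)" t by (rule reflected)
  obtain B' where B': "seqs.independent B'" "B' \<subseteq> Sol (\<lambda>i. b (t - i)) t UNIV" "card B' = card B"
    using B by (rule reflected_independent)
  have s': "CARD('d) * t \<le> card B' + s" using s B'(3) by simp
  \<comment> \<open>The reflected window \<open>{c..<c + int t}\<close> starts at the negative of
    its last site.\<close>
  define c' where "c' = 1 - c - int t"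
  have "(\<lambda>j. \<Psi> (- j)) \<in> Sol (\<lambda>i. b (t - i)) t {c'..<c' + int t + int s}"
    using Sol_reflect[OF \<Psi>] by (rule Sol_antimono) (auto simp: c'_def)
  then obtain \<Phi> where \<Phi>: "\<Phi> \<in> Sol (\<lambda>i. b (t - i)) t {c'..}" "\<forall>j\<in>{c'..<c' + int t}. \<Phi> j = \<Psi> (- j)"
    using r.extend_right[OF B'(1,2) s'] by blast
  have "(\<lambda>j. \<Phi> (- j)) \<in> Sol b t {..<c + int t}"
    using Sol_reflect_back[OF \<Phi>(1)] by (rule Sol_antimono) (auto simp: c'_def)
  moreover have "\<Phi> (- j) = \<Psi> j" if "j \<in> {c..<c + int t}" for j
    using \<Phi>(2)[rule_format, of "- j"] that by (auto simp: c'_def)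
  ultimately show ?thesis by (intro bexI[of _ "\<lambda>j. \<Phi> (- j)"]) auto
qed

lemma right_edge_support:
  assumes B: "seqs.independent B" "B \<subseteq> Sol b t UNIV" and s: "CARD('d) * t \<le> card B + s"
    and v: "v \<in> Sol b t {..R}" "v \<in> Vsub {R - int n<..R}"
  shows "v \<in> Vsub {R - int s<..R}"
proof -
  interpret r: regular_recurrence "\<lambda>i. b (t - i)" t by (rule reflected)
  obtain B' where B': "seqs.independent B'" "B' \<subseteq> Sol (\<lambda>i. b (t - i)) t UNIV" "card B' = card B"
    using B by (rule reflected_independent)
  have s': "CARD('d) * t \<le> card B' + s" using s B'(3) by simp
  have "(\<lambda>j. v (- j)) \<in> Sol (\<lambda>i. b (t - i)) t {- R..}"
    using Sol_reflect[OF v(1)] by (rule Sol_antimono) auto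
  moreover have "(\<lambda>j. v (- j)) \<in> Vsub {- R..<- R + int n}"
    using v(2) by (auto simp: Vsub_def)
  ultimately have *: "(\<lambda>j. v (- j)) \<in> Vsub {- R..<- R + int s}"
    by (rule r.left_edge_support[OF B'(1,2) s'])
  show ?thesis
    unfolding Vsub_def
  proof safe
    fix j assume "j \<notin> {R - int s<..R}"
    then have "- j \<notin> {- R..<- R + int s}" by auto
    with * have "v (- (- j)) = 0" unfolding Vsub_def by blast
    then show "v j = 0" by simp
  qed
qed

text \<open>Extending the state of an inner window to both infinities and gluing gives
  \<open>u\<close>. The remainder vanishes on that window, so it falls apart into two
  pieces.\<close>

lemma bulk_decomposition:
  assumes B: "seqs.independent B" "B \<subseteq> Sol b t UNIV" and s: "CARD('d) * t \<le> card B + s"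
    and LR: "2 * int s + int t \<le> R - L + 1"
    and \<Psi>: "\<Psi> \<in> Sol b t {L..R}" "\<Psi> \<in> Vsub {L..R}"
  obtains u v w where "u \<in> Sol b t UNIV" "v \<in> Sol b t {L..}" "v \<in> Vsub {L..<L + int s}"
    "w \<in> Sol b t {..R}" "w \<in> Vsub {L + int s..R}" "\<Psi> = proj {L..R} u + v + w"
proof -
  \<comment> \<open>The left margin is exactly \<open>s\<close>; the length hypothesis leaves at
    least \<open>s\<close> sites to the right of the window.\<close>
  define c where "c = L + int s"
  have c: "{c..<c + int t + int s} \<subseteq> {L..R}" "{c - int s..<c + int t} \<subseteq> {L..R}"
    using LR by (auto simp: c_def)
  obtain \<Phi>1 where \<Phi>1: "\<Phi>1 \<in> Sol b t {c..}" "\<forall>j\<in>{c..<c + int t}. \<Phi>1 j = \<Psi> j"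
    using extend_right[OF B s Sol_antimono[OF \<Psi>(1)], of c] c by blast
  obtain \<Phi>2 where \<Phi>2: "\<Phi>2 \<in> Sol b t {..<c + int t}" "\<forall>j\<in>{c..<c + int t}. \<Phi>2 j = \<Psi> j"
    using extend_left[OF B s Sol_antimono[OF \<Psi>(1)], of c] c by blast
  define u where "u = (\<lambda>j. if c \<le> j then \<Phi>1 j else \<Phi>2 j)"
  have u: "u \<in> Sol b t UNIV"
    unfolding u_def using \<Phi>1 \<Phi>2 by (intro Sol_glue) auto
  have uW: "u j = \<Psi> j" if "c \<le> j" "j < c + int t" for j
    using \<Phi>1(2) that by (auto simp: u_def)
  define d where "d = \<Psi> - proj {L..R} u"
  have "\<Psi> - u \<in> Sol b t {L..R}"
    using \<Psi>(1) Sol_antimono[OF u] by (intro seqs.subspace_diff[OF subspace_Sol]) auto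
  then have d: "d \<in> Sol b t {L..R}"
    by (rule Sol_cong) (auto simp: d_def proj_def)
  have dV: "d j = 0" if "j \<notin> {L..R}" for j
    using \<Psi>(2) that by (auto simp: d_def proj_def Vsub_def)
  have dW: "d j = 0" if "c \<le> j" "j < c + int t" for j
    using uW[OF that] dV[of j] by (cases "j \<in> {L..R}") (auto simp: d_def proj_def)
  \<comment> \<open>The \<open>t\<close> zeros from \<open>c\<close> on let each half of
    \<open>d\<close> be glued with zero, giving solutions on half lines.\<close>
  define v where "v = (\<lambda>j. if c \<le> j then 0 else d j)"
  define w where "w = (\<lambda>j. if c \<le> j then d j else 0)"
  show thesis
  proof
    show "u \<in> Sol b t UNIV" by (rule u)
    show "v \<in> Sol b t {L..}"
      unfolding v_def
    proof (rule Sol_glue[OF zero_in_Sol])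
      show "d \<in> Sol b t ({L..} \<inter> {..<c + int t})"
        using d by (rule Sol_antimono) (use LR in \<open>auto simp: c_def\<close>)
    qed (simp add: dW)
    show "w \<in> Sol b t {..R}"
      unfolding w_def
    proof (rule Sol_glue[OF _ zero_in_Sol])
      show "d \<in> Sol b t ({..R} \<inter> {c..})"
        using d by (rule Sol_antimono) (auto simp: c_def)
    qed (simp add: dW)
    show "v \<in> Vsub {L..<L + int s}" "w \<in> Vsub {L + int s..R}"
      using dV by (auto simp: v_def w_def Vsub_def c_def)
    show "\<Psi> = proj {L..R} u + v + w"
      by (auto simp: fun_eq_iff v_def w_def d_def)
  qed
qed

end

subsection \<open>Translation to bulk solution spaces\<close>

text \<open>Padding with zero coefficients widens the range to include \<open>0\<close>, so the
  block length is governed by \<open>\<tau>\<close> and the block of site \<open>j\<close> starts at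
  \<open>j + p'\<close>.\<close>

lemma bbl_eq_rec_eq:
  assumes "has_bandwidth a p q"
  shows "bbl a p q \<Psi> j
    = rec_eq (\<lambda>i. a (min p 0 + int i)) (nat (max 0 q - min p 0)) \<Psi> (j + min p 0)"
proof -
  have "bbl a p q \<Psi> j = (\<Sum>r\<in>{min p 0..max 0 q}. a r *v \<Psi> (j + r))"
    unfolding bbl_def using assms
    by (intro sum.mono_neutral_left) (auto simp: has_bandwidth_def)
  also have "\<dots> = rec_eq (\<lambda>i. a (min p 0 + int i)) (nat (max 0 q - min p 0)) \<Psi> (j + min p 0)"
    unfolding rec_eq_def
    by (rule sum.reindex_bij_witness[of _ "\<lambda>i. min p 0 + int i" "\<lambda>r. nat (r - min p 0)"])
       (auto simp: add.assoc)
  finally show ?thesis .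
qed

lemma bulk_eq_Sol:
  assumes "has_bandwidth a p q"
    and "\<And>k. {k..k + int (nat (max 0 q - min p 0))} \<subseteq> I \<longleftrightarrow> k - min p 0 \<in> S"
  shows "proj S (bbl a p q \<Psi>) = 0
    \<longleftrightarrow> \<Psi> \<in> Sol (\<lambda>i. a (min p 0 + int i)) (nat (max 0 q - min p 0)) I"
proof -
  have "(\<forall>j\<in>S. f (j + min p 0) = 0) \<longleftrightarrow> (\<forall>k. k - min p 0 \<in> S \<longrightarrow> f k = 0)"
    for f :: "int \<Rightarrow> complex ^ 'a"
    by (metis add_diff_cancel_right' diff_add_cancel)
  then show ?thesis
    unfolding Sol_def proj_eq_0_iff bbl_eq_rec_eq[OF assms(1)] assms(2) by simp
qed

section \<open>Nilpotency under truncated shifts as finite support\<close>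

lemma truncated_shiftL_funpow:
  assumes "L \<le> j"
  shows "((proj {L..} \<circ> shiftL) ^^ k) \<Psi> j = \<Psi> (j + int k)"
  using assms
proof (induction k arbitrary: j)
  case (Suc k)
  then have "((proj {L..} \<circ> shiftL) ^^ Suc k) \<Psi> j = ((proj {L..} \<circ> shiftL) ^^ k) \<Psi> (j + 1)"
    by (simp add: proj_def shiftL_def)
  also have "\<dots> = \<Psi> (j + 1 + int k)" using Suc.prems by (intro Suc.IH) simp
  also have "\<dots> = \<Psi> (j + int (Suc k))" by (simp add: algebra_simps)
  finally show ?case .
qed simp

lemma truncated_shiftR_funpow:
  assumes "j \<le> R"
  shows "((proj {..R} \<circ> shiftR) ^^ k) \<Psi> j = \<Psi> (j - int k)"
  using assms
proof (induction k arbitrary: j)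
  case (Suc k)
  then have "((proj {..R} \<circ> shiftR) ^^ Suc k) \<Psi> j = ((proj {..R} \<circ> shiftR) ^^ k) \<Psi> (j - 1)"
    by (simp add: proj_def shiftR_def)
  also have "\<dots> = \<Psi> (j - 1 - int k)" using Suc.prems by (intro Suc.IH) simp
  also have "\<dots> = \<Psi> (j - int (Suc k))" by (simp add: algebra_simps)
  finally show ?case .
qed simp

lemma truncated_shiftL_nilpotent_iff:
  assumes "\<Psi> \<in> Vsub {L..}"
  shows "(\<exists>k\<ge>1. ((proj {L..} \<circ> shiftL) ^^ k) \<Psi> = 0) \<longleftrightarrow> (\<exists>n. \<Psi> \<in> Vsub {L..<L + int n})"
proof safe
  fix k :: nat
  assume k: "((proj {L..} \<circ> shiftL) ^^ k) \<Psi> = 0"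
  have "\<Psi> j = 0" if "j \<ge> L + int k" for j
    using truncated_shiftL_funpow[of L "j - int k" k \<Psi>] k that by simp
  then show "\<exists>n. \<Psi> \<in> Vsub {L..<L + int n}"
    using assms by (intro exI[of _ k]) (auto simp: Vsub_def)
next
  fix n assume n: "\<Psi> \<in> Vsub {L..<L + int n}"
  \<comment> \<open>The extra factor makes the exponent positive and ensures an outermost projection
    that clears the sites left of \<open>L\<close>.\<close>
  have "((proj {L..} \<circ> shiftL) ^^ Suc n) \<Psi> j = 0" for j
  proof (cases "L \<le> j")
    case True
    then show ?thesis
      using truncated_shiftL_funpow[OF True, of "Suc n" \<Psi>] n by (simp add: Vsub_def)
  qed (simp add: proj_def)
  then show "\<exists>k\<ge>1. ((proj {L..} \<circ> shiftL) ^^ k) \<Psi> = 0"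
    by (intro exI[of _ "Suc n"]) (auto simp: fun_eq_iff)
qed

lemma truncated_shiftR_nilpotent_iff:
  assumes "\<Psi> \<in> Vsub {..R}"
  shows "(\<exists>k\<ge>1. ((proj {..R} \<circ> shiftR) ^^ k) \<Psi> = 0) \<longleftrightarrow> (\<exists>n. \<Psi> \<in> Vsub {R - int n<..R})"
proof safe
  fix k :: nat
  assume k: "((proj {..R} \<circ> shiftR) ^^ k) \<Psi> = 0"
  have "\<Psi> j = 0" if "j \<le> R - int k" for j
    using truncated_shiftR_funpow[of "j + int k" R k \<Psi>] k that by simp
  then show "\<exists>n. \<Psi> \<in> Vsub {R - int n<..R}"
    using assms by (intro exI[of _ k]) (auto simp: Vsub_def)
next
  fix n assume n: "\<Psi> \<in> Vsub {R - int n<..R}"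
  have "((proj {..R} \<circ> shiftR) ^^ Suc n) \<Psi> j = 0" for j
  proof (cases "j \<le> R")
    case True
    then show ?thesis
      using truncated_shiftR_funpow[OF True, of "Suc n" \<Psi>] n by (simp add: Vsub_def)
  qed (simp add: proj_def)
  then show "\<exists>k\<ge>1. ((proj {..R} \<circ> shiftR) ^^ k) \<Psi> = 0"
    by (intro exI[of _ "Suc n"]) (auto simp: fun_eq_iff)
qed

section \<open>The direct sum decomposition on a finite interval\<close>

theorem mainTheorem11:
  fixes a :: "'d::finite lpoly" and p q L R :: int
  assumes "has_bandwidth a p q"
    and "regular a p q"
    and "L \<le> R"
    and "R - L + 1 \<ge>
           2 * (int CARD('d) * (max 0 q - min p 0) - int (cdim (kerA a p q)))
           + (max 0 q - min p 0)"
  shows "direct_sum3 (Mfin a p q L R) (proj {L..R} ` kerA a p q)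
           (Fminus a p q L) (Fplus a p q R)"
proof -
  define b where "b = (\<lambda>i. a (min p 0 + int i))"
  define t where "t = nat (max 0 q - min p 0)"
  have t: "int t = max 0 q - min p 0" by (simp add: t_def)
  note Sol_iff = bulk_eq_Sol[OF assms(1), folded b_def t_def]
  have "proj UNIV \<Psi> = \<Psi>" for \<Psi> :: "'d seq" by (simp add: proj_def)
  with Sol_iff[of UNIV UNIV] have K: "kerA a p q = Sol b t UNIV"
    unfolding kerA_def by auto
  have window: "{k..k + int t} \<subseteq> {L..R} \<longleftrightarrow> k - min p 0 \<in> {L - min p 0..R - max 0 q}"
    "{k..k + int t} \<subseteq> {L..} \<longleftrightarrow> k - min p 0 \<in> {L - min p 0..}"
    "{k..k + int t} \<subseteq> {..R} \<longleftrightarrow> k - min p 0 \<in> {..R - max 0 q}" for k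
    using t by (auto simp: subset_iff dest: spec[of _ k] spec[of _ "k + int t"])
  have M: "Mfin a p q L R = {\<Psi> \<in> Vsub {L..R}. \<Psi> \<in> Sol b t {L..R}}"
    unfolding Mfin_def using Sol_iff[OF window(1)] by simp
  have Fm: "Fminus a p q L = {\<Psi> \<in> Vsub {L..}. \<Psi> \<in> Sol b t {L..} \<and> (\<exists>n. \<Psi> \<in> Vsub {L..<L + int n})}"
    unfolding Fminus_def Mright_def using Sol_iff[OF window(2)] truncated_shiftL_nilpotent_iff by blast
  have Fp: "Fplus a p q R = {\<Psi> \<in> Vsub {..R}. \<Psi> \<in> Sol b t {..R} \<and> (\<exists>n. \<Psi> \<in> Vsub {R - int n<..R})}"
    unfolding Fplus_def Mleft_def using Sol_iff[OF window(3)] truncated_shiftR_nilpotent_iff by blast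

  interpret regular_recurrence b t
  proof
    fix \<Psi> J assume "\<Psi> \<in> Sol b t UNIV"
    then have *: "\<Psi> \<in> kerA a p q" by (simp add: K)
    show "\<Psi> = 0" if "\<And>j. j < J \<Longrightarrow> \<Psi> j = 0"
      using that by (intro regular_kernel_eq_zero[OF assms(2) *, of J]) simp
    show "\<Psi> = 0" if "\<And>j. j > J \<Longrightarrow> \<Psi> j = 0"
      using that by (intro regular_kernel_eq_zero[OF assms(2) *, of J]) simp
  qed

  obtain B where B: "B \<subseteq> Sol b t UNIV" "seqs.independent B" "card B = cdim (kerA a p q)"
    unfolding cdim_def K using seqs.basis_exists by metis
  \<comment> \<open>This bound makes the natural-number subtraction in \<open>s\<close> exact, so
    \<open>s\<close> is \<open>\<sigma>\<close>.\<close>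
  have "card B \<le> CARD('d) * t"
    using card_independent_window[OF B(2,1) subspace_Sol, of 0 t] kernel_zero_window[of _ 0] by auto
  define s where "s = CARD('d) * t - card B"
  have s: "CARD('d) * t \<le> card B + s" by (simp add: s_def)
  have "int s = int CARD('d) * (max 0 q - min p 0) - int (cdim (kerA a p q))"
    using \<open>card B \<le> _\<close> by (simp add: s_def of_nat_diff B(3) flip: t)
  then have LR: "2 * int s + int t \<le> R - L + 1" using assms(4) t by simp
  have supp_minus: "v \<in> Vsub {L..<L + int s}" if "v \<in> Fminus a p q L" for v
    using that left_edge_support[OF B(2,1) s] unfolding Fm by blast
  have supp_plus: "w \<in> Vsub {R - int s<..R}" if "w \<in> Fplus a p q R" for w
    using that right_edge_support[OF B(2,1) s] unfolding Fp by blast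

  show ?thesis
    unfolding direct_sum3_def
  proof (intro conjI ballI impI set_eqI iffI)
    fix \<Psi> assume "\<Psi> \<in> Mfin a p q L R"
    then have "\<Psi> \<in> Sol b t {L..R}" "\<Psi> \<in> Vsub {L..R}" by (auto simp: M)
    with bulk_decomposition[OF B(2,1) s LR] obtain u v w where
      uvw: "u \<in> Sol b t UNIV" "v \<in> Sol b t {L..}" "v \<in> Vsub {L..<L + int s}"
        "w \<in> Sol b t {..R}" "w \<in> Vsub {L + int s..R}" "\<Psi> = proj {L..R} u + v + w"
      by metis
    have v: "v \<in> Fminus a p q L" using uvw(2,3) by (auto simp: Fm Vsub_def)
    have "w \<in> Vsub {R - int (nat (R - L + 1))<..R}"
      using uvw(5) \<open>L \<le> R\<close> by (auto simp: Vsub_def)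
    moreover have "w \<in> Vsub {..R}" using uvw(5) by (auto simp: Vsub_def)
    ultimately have "w \<in> Fplus a p q R" using uvw(4) unfolding Fp by blast
    with v show "\<Psi> \<in> {u + v + w |u v w. u \<in> proj {L..R} ` kerA a p q
        \<and> v \<in> Fminus a p q L \<and> w \<in> Fplus a p q R}"
      using uvw(1,6) unfolding K by blast
  next
    fix \<Psi> assume "\<Psi> \<in> {u + v + w |u v w. u \<in> proj {L..R} ` kerA a p q
        \<and> v \<in> Fminus a p q L \<and> w \<in> Fplus a p q R}"
    then obtain u v w where uvw: "u \<in> Sol b t UNIV" "v \<in> Fminus a p q L" "w \<in> Fplus a p q R"
        "\<Psi> = proj {L..R} u + v + w"
      unfolding K by blast
    have "proj {L..R} u \<in> Sol b t {L..R}"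
      using Sol_antimono[OF uvw(1), of "{L..R}"] by (rule Sol_cong) (auto simp: proj_def)
    moreover have "v \<in> Sol b t {L..R}" "w \<in> Sol b t {L..R}"
      using uvw(2,3) by (auto simp: Fm Fp intro: Sol_antimono)
    ultimately have "\<Psi> \<in> Sol b t {L..R}"
      unfolding uvw(4) by (intro seqs.subspace_add[OF subspace_Sol])
    \<comment> \<open>Edge solutions reach at most \<open>s\<close> sites inwards, and the interval
      has at least \<open>2 * s + t\<close> sites, so they stay inside it.\<close>
    moreover have "\<Psi> \<in> Vsub {L..R}"
      unfolding uvw(4)
      using supp_minus[OF uvw(2)] supp_plus[OF uvw(3)] LR
      by (intro seqs.subspace_add[OF subspace_Vsub]) (auto simp: Vsub_def proj_def)
    ultimately show "\<Psi> \<in> Mfin a p q L R" by (simp add: M)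
  next
    fix u v w assume uvw: "u \<in> proj {L..R} ` kerA a p q" "v \<in> Fminus a p q L" "w \<in> Fplus a p q R"
      and sum: "u + v + w = 0"
    from uvw(1) obtain u' where u': "u' \<in> Sol b t UNIV" "u = proj {L..R} u'" by (auto simp: K)
    have v: "v j = 0" if "j \<ge> L + int s" for j
      using supp_minus[OF uvw(2)] that by (auto simp: Vsub_def)
    have w: "w j = 0" if "j \<le> R - int s" for j
      using supp_plus[OF uvw(3)] that by (auto simp: Vsub_def)
    \<comment> \<open>Between the two edge supports there remains a window of \<open>t\<close> sites
      on which the relation reduces to \<open>u' = 0\<close>.\<close>
    have "u' = 0"
    proof (rule kernel_zero_window[OF u'(1), of "L + int s"])
      fix j assume j: "L + int s \<le> j" "j < L + int s + int t"
      then have "v j = 0" "w j = 0" using LR by (auto intro: v w)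
      with fun_cong[OF sum, of j] j LR show "u' j = 0" by (simp add: u'(2) proj_def)
    qed
    then have "u = 0" by (simp add: u'(2) proj_def fun_eq_iff)
    with sum have vw: "v j + w j = 0" for j by (simp add: fun_eq_iff)
    \<comment> \<open>The two edge supports are disjoint, so at each site one summand vanishes and
      hence so does the other.\<close>
    have "v j = 0 \<and> w j = 0" for j
      using v[of j] w[of j] vw[of j] LR by (cases "j \<ge> L + int s") auto
    with \<open>u = 0\<close> show "u = 0" "v = 0" "w = 0" by (auto simp: fun_eq_iff)
  qed
qed

end
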